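(* Let $(X_n)_{n\ge0}$ be a (non-homogeneous) Markov process in discrete time on $S$ with one-step transition kernels $\mathbb P_{t,x}(t+1,dy)$, $t=0,1,2,\dots$. For a probability measure $\nu$ on $S$ let $\mathbb P_\nu(n,\cdot)$ denote the law of $X_n$ when $X_0\sim\nu$. Then in all cases, for any two initial distributions $\mu^1,\mu^2$ on $S$, $$\limsup_{n\to\infty}\frac1n\ln\|\mathbb P_{\mu^1}(n,\cdot)-\mathbb P_{\mu^2}(n,\cdot)\|_{TV}\le\limsup_{n\to\infty}\frac1n\ln\int\prod_{i=0}^{n-1}\hat V_i\mathbf 1(x^1,x^2)\,1(x^1\ne x^2)\,\mu^1(dx^1)\,\mu^2(dx^2),$$ where $\prod_{i=0}^{n-1}\hat V_i=\hat V_0\hat V_1\cdots\hat V_{n-1}$, the operators $\hat V_t$ are defined in the context through the coupled pair $\tilde X$, and $\mathbf 1$ is the function identically equal to $1$.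
   Context: $S$ is a topological space with its Borel $\sigma$-algebra, and all singletons are measurable; $x\mapsto\mathbb P_{t,x}(t+1,A)$ is measurable for each measurable $A$. $\|\cdot\|_{TV}$ is the total variation distance, normalized so that $\|\nu-\nu'\|_{TV}=2\sup_A|\nu(A)-\nu'(A)|$ for probability measures. Convention: $\ln0=-\infty$. For $x^1,x^2\in S$, $t\ge0$, put $$\kappa_t(x^1,x^2)=\int\Big(\frac{\mathbb P_{t,x^2}(t+1,dy)}{\mathbb P_{t,x^1}(t+1,dy)}\wedge1\Big)\mathbb P_{t,x^1}(t+1,dy),$$ where the ratio is the density of the absolutely continuous component of the numerator with respect to the denominator (this is symmetric in $x^1,x^2$). Let $\Lambda_{t,x^1,x^2}=(\mathbb P_{t,x^1}(t+1,\cdot)+\mathbb P_{t,x^2}(t+1,\cdot))/2$ and let $p_t(x^i,\cdot)$ be the density of $\mathbb P_{t,x^i}(t+1,\cdot)$ with respect to it. Coupled pair. Let $(\eta^1_t,\eta^2_t,\xi_t,\zeta_t)$ be the Markov process on $S^3\times\{0,1\}$ such that, given the state $(x^1,x^2,x^3,x^4)$ at time $t$, the four components at time $t+1$ are conditionally independent and distributed as follows. The first and second components have densities with respect to $\Lambda_{t,x^1,x^2}$ $$\frac{p_t(x^1,u)-p_t(x^1,u)\wedge p_t(x^2,u)}{1-\kappa_t(x^1,x^2)}\quad\text{and}\quad\frac{p_t(x^2,u)-p_t(x^1,u)\wedge p_t(x^2,u)}{1-\kappa_t(x^1,x^2)}$$ respectively (if $\kappa_t(x^1,x^2)=1$, both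 have density $p_t(x^1,u)$). The third component has density $p_t(x^1,u)\wedge p_t(x^2,u)/\kappa_t(x^1,x^2)$ with respect to $\Lambda_{t,x^1,x^2}$ if $x^4=1$, and has law $\mathbb P_{t,x^3}(t+1,\cdot)$ if $x^4=0$ (if $\kappa_t(x^1,x^2)=0$, it has law $\mathbb P_{t,x^3}(t+1,\cdot)$ in both cases). The fourth component equals $0$ with probability $\kappa_t(x^1,x^2)$ and $1$ with probability $1-\kappa_t(x^1,x^2)$ if $x^4=1$, and equals $0$ if $x^4=0$. Put $$\tilde X^i_t=\eta^i_t1(\zeta_t=1)+\xi_t1(\zeta_t=0),\quad i=1,2,\qquad \tilde X_t=(\tilde X^1_t,\tilde X^2_t).$$ $\mathbb E_{t,x^1,x^2}$ is expectation for the start $\tilde X_t=(x^1,x^2)$ at time $t$: for $x^1\ne x^2$ this means $\eta^1_t=x^1$, $\eta^2_t=x^2$, $\xi_t=x^1$, $\zeta_t=1$; for $x^1=x^2$ it means $\eta^1_t=\eta^2_t=\xi_t=x^1$, $\zeta_t=0$. Thus each component of $\tilde X$ is a Markov process with the transition kernels of $(X_n)$; from $x^1\neq x^2$ at time $t$ the two components jump to a common point with probability $\kappa_t(x^1,x^2)$, and once equal they stay equal. Let $\hat S^2=S^2\setminus\{(x,x):x\in S\}$. The operator $\hat V_t$ acts on bounded Borel measurable functions $\hat h:\hat S^2\to\mathbb R$ (taken as $0$ on the diagonal) by $$\hat V_t\hat h(x)=(1-\kappa_t(x^1,x^2))\,\mathbb E_{t,x^1,x^2}\hat h(\tilde X_{t+1}),\qquad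 x=(x^1,x^2)\in\hat S^2.$$
   Formalization: In the operator V̂_t the expectation of h(X̃_{t+1}) is taken conditionally on the pair not being coupled at that step (ζ_{t+1}=1), so the factor 1−κ_t counts once; with the unconditional expectation the inequality fails, e.g. for a two-state chain. *)

theory Defs
  imports "HOL-Probability.Probability"
begin

text \<open>The law of the chain at time \<open>n\<close>, with \<open>P t x\<close> the law of the state at time \<open>t + 1\<close>
  given the state \<open>x\<close> at time \<open>t\<close>.\<close>

primrec law_at :: "(nat \<Rightarrow> 'a \<Rightarrow> 'a measure) \<Rightarrow> 'a measure \<Rightarrow> nat \<Rightarrow> 'a measure" where
  "law_at P \<nu> 0 = \<nu>"
| "law_at P \<nu> (Suc n) = law_at P \<nu> n \<bind> P n"

definition tv_norm :: "'a measure \<Rightarrow> 'a measure \<Rightarrow> real" where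
  "tv_norm M N = 2 * (SUP A\<in>sets M. \<bar>measure M A - measure N A\<bar>)"

text \<open>A density of the \<open>M\<close>-absolutely continuous component of \<open>N\<close>. In the Lebesgue decomposition
  the singular component is the restriction of \<open>N\<close> to an \<open>M\<close>-null set \<open>Z\<close>. (The library's
  \<open>RN_deriv\<close> is \<open>0\<close> unless \<open>N\<close> itself has a density.)\<close>

definition ac_deriv :: "'a measure \<Rightarrow> 'a measure \<Rightarrow> 'a \<Rightarrow> ennreal" where
  "ac_deriv M N = (SOME f. f \<in> borel_measurable M \<and>
     (\<exists>Z\<in>null_sets M. \<forall>A\<in>sets M.
        emeasure N A = emeasure (density M f) A + emeasure N (A \<inter> Z)))"

definition kappa :: "(nat \<Rightarrow> 'a \<Rightarrow> 'a measure) \<Rightarrow> nat \<Rightarrow> 'a \<Rightarrow> 'a \<Rightarrow> real" where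
  "kappa P t x1 x2 = enn2real (\<integral>\<^sup>+ y. min (ac_deriv (P t x1) (P t x2) y) 1 \<partial>(P t x1))"

definition mid_measure :: "'a measure \<Rightarrow> 'a measure \<Rightarrow> 'a measure" where
  "mid_measure M N =
     measure_of (space M) (sets M) (\<lambda>A. (emeasure M A + emeasure N A) / 2)"

definition Lam :: "(nat \<Rightarrow> 'a \<Rightarrow> 'a measure) \<Rightarrow> nat \<Rightarrow> 'a \<Rightarrow> 'a \<Rightarrow> 'a measure" where
  "Lam P t x1 x2 = mid_measure (P t x1) (P t x2)"

text \<open>One step of the coupled process from the state \<open>(x1, x2, x3, x4)\<close>; the state space
  \<open>{0, 1}\<close> of the last component is \<open>bool\<close>, with \<open>True\<close> for \<open>1\<close> (not yet coupled).\<close>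

definition coupled_step ::
  "(nat \<Rightarrow> 'a \<Rightarrow> 'a measure) \<Rightarrow> nat \<Rightarrow> 'a \<times> 'a \<times> 'a \<times> bool \<Rightarrow> ('a \<times> 'a \<times> 'a \<times> bool) measure"
  where
  "coupled_step P t = (\<lambda>(x1, x2, x3, x4).
     let \<Lambda> = Lam P t x1 x2;
         p1 = RN_deriv \<Lambda> (P t x1);
         p2 = RN_deriv \<Lambda> (P t x2);
         \<kappa> = kappa P t x1 x2;
         N1 = density \<Lambda> (if \<kappa> = 1 then p1
                else (\<lambda>u. (p1 u - min (p1 u) (p2 u)) / ennreal (1 - \<kappa>)));
         N2 = density \<Lambda> (if \<kappa> = 1 then p1
                else (\<lambda>u. (p2 u - min (p1 u) (p2 u)) / ennreal (1 - \<kappa>)));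
         N3 = (if x4 \<and> \<kappa> \<noteq> 0
               then density \<Lambda> (\<lambda>u. min (p1 u) (p2 u) / ennreal \<kappa>)
               else P t x3);
         N4 = (if x4 then measure_pmf (bernoulli_pmf (1 - \<kappa>))
               else measure_pmf (return_pmf False))
     in N1 \<Otimes>\<^sub>M (N2 \<Otimes>\<^sub>M (N3 \<Otimes>\<^sub>M N4)))"

definition coupled_start :: "'a \<Rightarrow> 'a \<Rightarrow> 'a \<times> 'a \<times> 'a \<times> bool" where
  "coupled_start x1 x2 = (x1, x2, x1, x1 \<noteq> x2)"

definition uncoupled :: "('a \<times> 'a \<times> 'a \<times> bool) set" where
  "uncoupled = {(\<eta>1, \<eta>2, \<xi>, \<zeta>). \<zeta>}"

definition X_tilde :: "'a \<times> 'a \<times> 'a \<times> bool \<Rightarrow> 'a \<times> 'a" where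
  "X_tilde = (\<lambda>(\<eta>1, \<eta>2, \<xi>, \<zeta>). (if \<zeta> then \<eta>1 else \<xi>, if \<zeta> then \<eta>2 else \<xi>))"

definition off_diag :: "('a \<times> 'a \<Rightarrow> ennreal) \<Rightarrow> 'a \<times> 'a \<Rightarrow> ennreal" where
  "off_diag h = (\<lambda>(y1, y2). if y1 = y2 then 0 else h (y1, y2))"

text \<open>The expectation of \<open>h\<close> at the next state of \<open>X_tilde\<close> is taken conditionally on the two
  components not having been coupled in this step, an event of probability \<open>1 - kappa\<close>.
  Since \<open>h\<close> vanishes on the diagonal, the unconditional expectation already contains the
  factor \<open>1 - kappa\<close>; multiplying it by \<open>1 - kappa\<close> would count the factor twice, and the
  convergence bound would fail: the two-state chain with transition matrix
  \<open>((3/4, 1/4), (1/4, 3/4))\<close>, started from the two point masses, has total variation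
  distance \<open>2 * (1/2)^n\<close>, whereas the \<open>n\<close>-fold product would be \<open>(1/4)^n\<close>.

  Only nonnegative functions occur, so \<open>nn_integral\<close> is used. For a function that is not
  measurable with respect to the product sigma-algebra it is the lower integral, so
  no joint measurability in the pair of states has to be assumed.\<close>

definition V_hat ::
  "(nat \<Rightarrow> 'a \<Rightarrow> 'a measure) \<Rightarrow> nat \<Rightarrow> ('a \<times> 'a \<Rightarrow> ennreal) \<Rightarrow> 'a \<times> 'a \<Rightarrow> ennreal" where
  "V_hat P t h = off_diag (\<lambda>(x1, x2).
     ennreal (1 - kappa P t x1 x2) *
     (\<integral>\<^sup>+ s. off_diag h (X_tilde s)
        \<partial>(uniform_measure (coupled_step P t (coupled_start x1 x2)) uncoupled)))"

text \<open>The composition \<open>V_hat P 0 \<circ> V_hat P 1 \<circ> \<dots> \<circ> V_hat P (n - 1)\<close>.\<close>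

definition V_hat_prod ::
  "(nat \<Rightarrow> 'a \<Rightarrow> 'a measure) \<Rightarrow> nat \<Rightarrow> ('a \<times> 'a \<Rightarrow> ennreal) \<Rightarrow> 'a \<times> 'a \<Rightarrow> ennreal" where
  "V_hat_prod P n = foldr (\<lambda>t. (\<circ>) (V_hat P t)) [0..<n] id"

definition ext_ln :: "ennreal \<Rightarrow> ereal" where
  "ext_ln x = (if x = 0 then -\<infinity> else if x = \<top> then \<infinity> else ereal (ln (enn2real x)))"

end

theory Submission
  imports Defs
begin

text \<open>
  Total variation is dual to the coupling. Let \<open>h\<close> be measurable with values in \<open>[0, 1]\<close> and let
  \<open>H x\<close> be the expectation of \<open>h\<close> at time \<open>n\<close> for the chain started from \<open>x\<close>. Removing the common
  part of two one-step laws leaves the residual laws of the uncoupled components, so by backward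
  induction \<open>H x1 - H x2\<close> is at most the iterated operator applied to \<open>1\<close>, for \<open>x1 \<noteq> x2\<close>.
  Integrating over \<open>\<mu>1 \<Otimes>\<^sub>M \<mu>2\<close> with \<open>h\<close> an indicator bounds the total variation distance by twice the
  integral on the right, and the factor \<open>2\<close> disappears in the exponential rate.
\<close>

section \<open>The average of two measures as a reference measure\<close>

lemma space_mid_measure [simp]: "space (mid_measure M N) = space M"
  and sets_mid_measure [simp, measurable_cong]: "sets (mid_measure M N) = sets M"
  by (simp_all add: mid_measure_def)

lemma emeasure_mid_measure:
  assumes "sets N = sets M" "A \<in> sets M"
  shows "emeasure (mid_measure M N) A = (emeasure M A + emeasure N A) / 2"
  unfolding mid_measure_def
proof (rule emeasure_measure_of_sigma)
  show "sigma_algebra (space M) (sets M)" ..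
  show "positive (sets M) (\<lambda>A. (emeasure M A + emeasure N A) / 2)"
    by (simp add: positive_def)
  show "countably_additive (sets M) (\<lambda>A. (emeasure M A + emeasure N A) / 2)"
  proof (rule countably_additiveI)
    fix A :: "nat \<Rightarrow> _" assume A: "range A \<subseteq> sets M" "disjoint_family A"
    show "(\<Sum>i. (emeasure M (A i) + emeasure N (A i)) / 2)
        = (emeasure M (\<Union> (range A)) + emeasure N (\<Union> (range A))) / 2"
      using A assms(1) by (simp add: suminf_add[symmetric] suminf_emeasure)
  qed
qed fact

lemma ennreal_half_eq_0_iff: "(a + b :: ennreal) / 2 = 0 \<longleftrightarrow> a = 0 \<and> b = 0"
  by (simp add: divide_ennreal_def)

text \<open>A null set of the average is null for both summands. Together with finiteness this makes
  \<open>RN_deriv\<close> with respect to \<open>Lam\<close> a genuine density of each one-step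
  law.\<close>

lemma absolutely_continuous_mid_measure:
  assumes "sets N = sets M"
  shows "absolutely_continuous (mid_measure M N) M"
    and "absolutely_continuous (mid_measure M N) N"
  using assms
  by (auto simp: absolutely_continuous_def null_sets_def emeasure_mid_measure ennreal_half_eq_0_iff)

lemma finite_measure_mid_measure:
  assumes "finite_measure M" "finite_measure N" "sets N = sets M"
  shows "finite_measure (mid_measure M N)"
proof
  have "space N = space M" using assms(3) by (rule sets_eq_imp_space_eq)
  then have "emeasure N (space M) \<noteq> \<infinity>"
    using finite_measure.emeasure_finite[OF assms(2), of "space M"] by simp
  then show "emeasure (mid_measure M N) (space (mid_measure M N)) \<noteq> \<infinity>"
    using finite_measure.emeasure_finite[OF assms(1)] assms(3)
    by (simp add: emeasure_mid_measure ennreal_divide_eq_top_iff)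
qed

section \<open>Overlap of two laws and \<open>kappa\<close>\<close>

text \<open>Identifies \<open>kappa\<close> with the mass of the common part \<open>min p q\<close>.
  Where \<open>p\<close> is positive and finite, the absolutely continuous part has density
  \<open>q / p\<close>, and multiplying \<open>min (q / p) 1\<close> by \<open>p\<close> gives
  \<open>min p q\<close>; where \<open>p\<close> vanishes, both integrands do. Since
  \<open>ac_deriv\<close> is a choice, an arbitrary decomposition has to be treated.\<close>

lemma ac_deriv_overlap:
  assumes L: "sigma_finite_measure L"
    and p [measurable]: "p \<in> borel_measurable L" and q [measurable]: "q \<in> borel_measurable L"
    and fin: "(\<integral>\<^sup>+ x. p x \<partial>L) \<noteq> \<infinity>"
  shows "(\<integral>\<^sup>+ x. min (ac_deriv (density L p) (density L q) x) 1 \<partial>density L p)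
       = (\<integral>\<^sup>+ x. min (p x) (q x) \<partial>L)"
proof -
  define M where "M = density L p"
  define N where "N = density L q"
  define dec where "dec f Z \<longleftrightarrow> f \<in> borel_measurable M \<and> Z \<in> null_sets M \<and> (\<forall>A\<in>sets M.
        emeasure N A = emeasure (density M f) A + emeasure N (A \<inter> Z))" for f Z
  have sets_M [simp, measurable_cong]: "sets M = sets L" and sets_N [simp, measurable_cong]: "sets N = sets L"
    by (simp_all add: M_def N_def)
  \<comment> \<open>Division by infinity gives 0 in \<open>ennreal\<close>, so the cancellation
    \<open>p x * (q x / p x) = q x\<close> requires \<open>p x\<close> to be finite.\<close>
  have finp: "AE x in L. p x \<noteq> \<infinity>" by (rule nn_integral_PInf_AE[OF p fin])
  \<comment> \<open>This candidate shows that the choice in \<open>ac_deriv\<close> succeeds. Its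
    value where \<open>p\<close> vanishes is immaterial, since \<open>density L p\<close> gives that
    set no mass.\<close>
  have "dec (\<lambda>x. q x / p x) {x\<in>space L. p x = 0}"
    unfolding dec_def
  proof (intro conjI ballI)
    show "(\<lambda>x. q x / p x) \<in> borel_measurable M" by measurable
    show "{x\<in>space L. p x = 0} \<in> null_sets M"
      unfolding M_def by (subst null_sets_density_iff) auto
    fix A assume "A \<in> sets M"
    then have [measurable]: "A \<in> sets L" by simp
    have "emeasure N A = (\<integral>\<^sup>+ x. q x * indicator A x \<partial>L)"
      by (simp add: N_def emeasure_density)
    also have "\<dots> = (\<integral>\<^sup>+ x. p x * (q x / p x * indicator A x) + q x * indicator (A \<inter> {x\<in>space L. p x = 0}) x \<partial>L)"
    proof (rule nn_integral_cong_AE, use finp AE_space in eventually_elim)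
      case (elim x)
      show ?case
      proof (cases "p x = 0")
        case False
        then have "p x * (q x / p x) = q x"
          using elim by (simp add: ennreal_times_divide mult.commute[of "p x"] ennreal_mult_divide_eq)
        then show ?thesis using False by (simp add: mult.assoc[symmetric])
      qed (use elim in \<open>auto split: split_indicator\<close>)
    qed
    also have "\<dots> = emeasure (density M (\<lambda>x. q x / p x)) A + emeasure N (A \<inter> {x\<in>space L. p x = 0})"
      by (simp add: nn_integral_add emeasure_density nn_integral_density M_def N_def)
    finally show "emeasure N A = \<dots>" .
  qed
  then have "\<exists>f. f \<in> borel_measurable M \<and> (\<exists>Z\<in>null_sets M. \<forall>A\<in>sets M.
        emeasure N A = emeasure (density M f) A + emeasure N (A \<inter> Z))"
    unfolding dec_def by blast
  from someI_ex[OF this] obtain Z where "dec (ac_deriv M N) Z"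
    unfolding ac_deriv_def dec_def by blast
  moreover define f where "f = ac_deriv M N"
  ultimately have f: "f \<in> borel_measurable M" and Z: "Z \<in> null_sets M"
    and eq: "\<And>A. A \<in> sets L \<Longrightarrow> emeasure N A = emeasure (density M f) A + emeasure N (A \<inter> Z)"
    by (auto simp: dec_def)
  have [measurable]: "f \<in> borel_measurable L" using f by simp
  have [measurable]: "Z \<in> sets L" using Z by (auto simp: null_sets_def)
  have pZ: "AE x in L. x \<in> Z \<longrightarrow> p x = 0"
    using Z unfolding M_def by (subst (asm) null_sets_density_iff) auto
  \<comment> \<open>Off \<open>Z\<close> the singular term disappears, so the two measures agree;
    uniqueness of densities then gives \<open>p * f = q\<close> almost everywhere off
    \<open>Z\<close>. The set \<open>Z\<close> need not be the zero set of \<open>p\<close>; all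
    that is known is that \<open>p\<close> vanishes almost everywhere on it.\<close>
  have "density L (\<lambda>x. p x * (f x * indicator (- Z) x)) = density L (\<lambda>x. q x * indicator (- Z) x)"
  proof (rule measure_eqI)
    fix A assume "A \<in> sets (density L (\<lambda>x. p x * (f x * indicator (- Z) x)))"
    then have [measurable]: "A \<in> sets L" by simp
    have "emeasure (density L (\<lambda>x. p x * (f x * indicator (- Z) x))) A
        = (\<integral>\<^sup>+ x. p x * (f x * indicator (A - Z) x) \<partial>L)"
      by (subst emeasure_density) (auto intro!: nn_integral_cong split: split_indicator)
    also have "\<dots> = emeasure (density M f) (A - Z)"
      by (simp add: M_def emeasure_density nn_integral_density)
    also have "\<dots> = emeasure N (A - Z)"
      using eq[of "A - Z"] by (simp add: Int_commute[of _ Z])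
    also have "\<dots> = (\<integral>\<^sup>+ x. q x * indicator (A - Z) x \<partial>L)"
      by (simp add: N_def emeasure_density)
    also have "\<dots> = emeasure (density L (\<lambda>x. q x * indicator (- Z) x)) A"
      by (subst emeasure_density) (auto intro!: nn_integral_cong split: split_indicator)
    finally show "emeasure (density L (\<lambda>x. p x * (f x * indicator (- Z) x))) A = \<dots>" .
  qed simp
  then have fq: "AE x in L. p x * (f x * indicator (- Z) x) = q x * indicator (- Z) x"
    by (intro sigma_finite_measure.density_unique[OF L]) auto
  have "(\<integral>\<^sup>+ x. min (f x) 1 \<partial>M) = (\<integral>\<^sup>+ x. p x * min (f x) 1 \<partial>L)"
    by (simp add: M_def nn_integral_density)
  also have "\<dots> = (\<integral>\<^sup>+ x. min (p x) (q x) \<partial>L)"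
  proof (rule nn_integral_cong_AE, use pZ fq in eventually_elim)
    case (elim x)
    show ?case
    proof (cases "x \<in> Z")
      case False
      then have "q x = p x * f x" using elim by simp
      moreover have "p x * min (f x) 1 = min (p x * f x) (p x * 1)"
        using mult_left_mono[of "f x" 1 "p x"] mult_left_mono[of 1 "f x" "p x"]
        by (cases "f x" "1 :: ennreal" rule: le_cases) (simp_all add: min_absorb1 min_absorb2)
      ultimately show ?thesis by (simp add: min.commute)
    qed (use elim in simp)
  qed
  finally show ?thesis unfolding f_def M_def N_def .
qed

section \<open>Marginals of the coupled step on the uncoupled event\<close>

text \<open>The four components are independent, so an integrand depending on one of the first two
  and on the fourth factorises. Dividing by the mass of the event shows that conditioning on
  \<open>uncoupled\<close> leaves the laws of the first two components unchanged.\<close>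

lemma
  fixes N4 :: "bool measure"
  assumes N: "prob_space N1" "prob_space N2" "prob_space N3" "prob_space N4"
    and N4 [simp]: "sets N4 = UNIV"
  defines "K \<equiv> N1 \<Otimes>\<^sub>M (N2 \<Otimes>\<^sub>M (N3 \<Otimes>\<^sub>M N4))"
  shows nn_integral_uncoupled_fst: "f \<in> borel_measurable N1 \<Longrightarrow>
      (\<integral>\<^sup>+ s. f (fst s) * indicator {s. snd (snd (snd s))} s \<partial>K)
      = (\<integral>\<^sup>+ x. f x \<partial>N1) * emeasure N4 {True}"
    and nn_integral_uncoupled_snd: "g \<in> borel_measurable N2 \<Longrightarrow>
      (\<integral>\<^sup>+ s. g (fst (snd s)) * indicator {s. snd (snd (snd s))} s \<partial>K)
      = (\<integral>\<^sup>+ x. g x \<partial>N2) * emeasure N4 {True}"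
proof -
  interpret N1: prob_space N1 by fact
  interpret N2: prob_space N2 by fact
  interpret N3: prob_space N3 by fact
  interpret N4: prob_space N4 by fact
  interpret N34: prob_space "N3 \<Otimes>\<^sub>M N4"
    by (intro prob_space_pair N)
  interpret N234: prob_space "N2 \<Otimes>\<^sub>M (N3 \<Otimes>\<^sub>M N4)"
    by (intro prob_space_pair N N34.prob_space_axioms)
  have *: "(\<integral>\<^sup>+ s. f (fst s) * g (fst (snd s)) * indicator {s. snd (snd (snd s))} s \<partial>K)
      = (\<integral>\<^sup>+ x. f x \<partial>N1) * ((\<integral>\<^sup>+ x. g x \<partial>N2) * emeasure N4 {True})"
    if [measurable]: "f \<in> borel_measurable N1" "g \<in> borel_measurable N2" for f g
  proof -
    define v :: "bool \<Rightarrow> ennreal" where "v = indicator {True}"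
    have [measurable]: "v \<in> borel_measurable N4"
      unfolding v_def by (rule borel_measurable_indicator) simp
    have int_v: "(\<integral>\<^sup>+ z. v z \<partial>N4) = emeasure N4 {True}"
      unfolding v_def by (rule nn_integral_indicator) simp
    have "(\<integral>\<^sup>+ s. f (fst s) * g (fst (snd s)) * indicator {s. snd (snd (snd s))} s \<partial>K)
        = (\<integral>\<^sup>+ s. f (fst s) * (g (fst (snd s)) * v (snd (snd (snd s)))) \<partial>K)"
      by (intro nn_integral_cong) (auto simp: v_def split: split_indicator)
    also have "\<dots> = (\<integral>\<^sup>+ x. f x * (\<integral>\<^sup>+ r. g (fst r) * v (snd (snd r)) \<partial>(N2 \<Otimes>\<^sub>M (N3 \<Otimes>\<^sub>M N4))) \<partial>N1)"
      unfolding K_def by (subst N234.nn_integral_fst[symmetric]) (simp_all add: nn_integral_cmult)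
    also have "(\<integral>\<^sup>+ r. g (fst r) * v (snd (snd r)) \<partial>(N2 \<Otimes>\<^sub>M (N3 \<Otimes>\<^sub>M N4)))
        = (\<integral>\<^sup>+ y. g y * (\<integral>\<^sup>+ w. v (snd w) \<partial>(N3 \<Otimes>\<^sub>M N4)) \<partial>N2)"
      by (subst N34.nn_integral_fst[symmetric]) (simp_all add: nn_integral_cmult)
    also have "(\<integral>\<^sup>+ w. v (snd w) \<partial>(N3 \<Otimes>\<^sub>M N4)) = emeasure N4 {True}"
      by (subst N4.nn_integral_fst[symmetric]) (simp_all add: int_v N3.emeasure_space_1)
    finally show ?thesis by (simp add: nn_integral_multc)
  qed
  show "f \<in> borel_measurable N1 \<Longrightarrow>
      (\<integral>\<^sup>+ s. f (fst s) * indicator {s. snd (snd (snd s))} s \<partial>K)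
      = (\<integral>\<^sup>+ x. f x \<partial>N1) * emeasure N4 {True}"
    using *[of f "\<lambda>_. 1"] by (simp add: N2.emeasure_space_1)
  show "g \<in> borel_measurable N2 \<Longrightarrow>
      (\<integral>\<^sup>+ s. g (fst (snd s)) * indicator {s. snd (snd (snd s))} s \<partial>K)
      = (\<integral>\<^sup>+ x. g x \<partial>N2) * emeasure N4 {True}"
    using *[of "\<lambda>_. 1" g] by (simp add: N1.emeasure_space_1)
qed

section \<open>Transition kernels and the backward evolution\<close>

locale markov_kernels =
  fixes P :: "nat \<Rightarrow> 'a::topological_space \<Rightarrow> 'a measure"
  assumes sets_kernel [simp, measurable_cong]: "sets (P t x) = sets borel"
    and prob_space_kernel: "prob_space (P t x)"
    and measurable_kernel: "A \<in> sets borel \<Longrightarrow> (\<lambda>x. measure (P t x) A) \<in> borel_measurable borel"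
begin

lemma space_kernel [simp]: "space (P t x) = UNIV"
  using sets_eq_imp_space_eq[OF sets_kernel] by simp

lemma kernel_subprob [measurable]: "P t \<in> borel \<rightarrow>\<^sub>M subprob_algebra borel"
proof (rule measurable_subprob_algebra)
  fix A :: "'a set" assume "A \<in> sets borel"
  moreover have "emeasure (P t x) A = ennreal (measure (P t x) A)" for x
    using prob_space_kernel[of t x]
    by (simp add: finite_measure.emeasure_eq_measure prob_space.finite_measure)
  ultimately show "(\<lambda>x. emeasure (P t x) A) \<in> borel_measurable borel"
    using measurable_kernel[of A t] by simp
qed (auto intro: prob_space_imp_subprob_space prob_space_kernel)

lemma sets_law_at: "sets \<nu> = sets borel \<Longrightarrow> sets (law_at P \<nu> n) = sets borel"
proof (induction n)
  case (Suc n)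
  \<comment> \<open>Nonemptiness matters: \<open>bind\<close> over an empty space is
    \<open>count_space {}\<close> by default.\<close>
  then have "space (law_at P \<nu> n) = UNIV"
    using sets_eq_imp_space_eq[of "law_at P \<nu> n" borel] by simp
  then show ?case by (simp add: sets_bind[where N = borel])
qed simp

lemma prob_space_law_at:
  assumes "prob_space \<nu>" "sets \<nu> = sets borel"
  shows "prob_space (law_at P \<nu> n)"
proof (induction n)
  case (Suc n)
  interpret prob_space "law_at P \<nu> n" by fact
  have "P n \<in> law_at P \<nu> n \<rightarrow>\<^sub>M subprob_algebra borel"
    by (simp add: measurable_cong_sets[OF sets_law_at[OF assms(2)] refl])
  then show ?case
    by (auto intro!: prob_space_bind[where S = borel] prob_space_kernel)
qed (simp add: assms)

text \<open>For \<open>ts = [0..<n]\<close> this is the expectation of \<open>h\<close> at time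
  \<open>n\<close> as a function of the state at time 0. The list form matches
  \<open>V_hat_prod\<close> and lets either the first or the last time be peeled off.\<close>

abbreviation backward :: "nat list \<Rightarrow> ('a \<Rightarrow> ennreal) \<Rightarrow> 'a \<Rightarrow> ennreal" where
  "backward ts h \<equiv> foldr (\<lambda>t h x. \<integral>\<^sup>+ y. h y \<partial>P t x) ts h"

lemma measurable_backward [measurable]:
  assumes "h \<in> borel_measurable borel"
  shows "backward ts h \<in> borel_measurable borel"
proof (induction ts)
  case (Cons t ts)
  then show ?case
    by (auto intro: measurable_compose[OF kernel_subprob] nn_integral_measurable_subprob_algebra)
qed (simp add: assms)

lemma backward_le_1:
  assumes "\<And>x. h x \<le> 1"
  shows "backward ts h x \<le> 1"
proof (induction ts arbitrary: x)
  case (Cons t ts)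
  have "(\<integral>\<^sup>+ y. backward ts h y \<partial>P t x) \<le> (\<integral>\<^sup>+ y. 1 \<partial>P t x)"
    by (intro nn_integral_mono Cons.IH)
  then show ?case
    by (simp add: prob_space.emeasure_space_1[OF prob_space_kernel, simplified])
qed (simp add: assms)

text \<open>Duality of forward laws and backward evolution. \<open>law_at\<close> composes the
  latest kernel last, so the induction peels off the last time and applies the hypothesis to
  \<open>backward [n] h\<close>; hence \<open>h\<close> is arbitrary.\<close>

lemma nn_integral_law_at:
  assumes "sets \<nu> = sets borel" and "h \<in> borel_measurable borel"
  shows "(\<integral>\<^sup>+ x. h x \<partial>law_at P \<nu> n) = (\<integral>\<^sup>+ x. backward [0..<n] h x \<partial>\<nu>)"
  using assms(2)
proof (induction n arbitrary: h)
  case (Suc n)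
  note [measurable] = Suc.prems
  have "P n \<in> law_at P \<nu> n \<rightarrow>\<^sub>M subprob_algebra borel"
    by (simp add: measurable_cong_sets[OF sets_law_at[OF assms(1)] refl])
  then have "(\<integral>\<^sup>+ x. h x \<partial>law_at P \<nu> (Suc n)) = (\<integral>\<^sup>+ x. backward [n] h x \<partial>law_at P \<nu> n)"
    by (simp add: nn_integral_bind[OF Suc.prems])
  also have "\<dots> = (\<integral>\<^sup>+ x. backward [0..<n] (backward [n] h) x \<partial>\<nu>)"
    by (rule Suc.IH) measurable
  finally show ?case by simp
qed simp

section \<open>One-step comparison through the residual laws\<close>

text \<open>\<open>h y1 - h y2\<close> is measurable for the product sigma-algebra although \<open>F\<close> and the diagonal
  need not be, so the lower integral over \<open>F\<close> in \<open>V_hat\<close> dominates it.\<close>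

lemma V_hat_bound:
  assumes h [measurable]: "h \<in> borel_measurable borel" and h_le: "\<And>x. h x \<le> 1"
    and F: "\<And>y1 y2. y1 \<noteq> y2 \<Longrightarrow> h y1 \<le> h y2 + F (y1, y2)"
    and "x1 \<noteq> x2"
  shows "(\<integral>\<^sup>+ y. h y \<partial>P t x1) \<le> (\<integral>\<^sup>+ y. h y \<partial>P t x2) + V_hat P t F (x1, x2)"
proof -
  define L where "L = Lam P t x1 x2"
  define p where "p = RN_deriv L (P t x1)"
  define q where "q = RN_deriv L (P t x2)"
  \<comment> \<open>The \<open>L\<close>-density of the common part of the two laws.\<close>
  define m where "m u = min (p u) (q u)" for u
  define \<kappa> where "\<kappa> = kappa P t x1 x2"
  have sets_L [simp, measurable_cong]: "sets L = sets borel" by (simp add: L_def Lam_def)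
  have [simp]: "space L = UNIV" by (simp add: L_def Lam_def)
  interpret L: finite_measure L
    unfolding L_def Lam_def
    by (intro finite_measure_mid_measure prob_space.finite_measure prob_space_kernel) simp
  have [measurable]: "p \<in> borel_measurable borel" "q \<in> borel_measurable borel"
    using borel_measurable_RN_deriv[of L "P t x1"] borel_measurable_RN_deriv[of L "P t x2"]
    by (simp_all add: p_def q_def)
  have [measurable]: "m \<in> borel_measurable borel" unfolding m_def by measurable
  have P1: "density L p = P t x1" and P2: "density L q = P t x2"
    unfolding p_def q_def
    by (rule L.density_RN_deriv; simp add: L_def Lam_def absolutely_continuous_mid_measure)+
  have int_P1: "(\<integral>\<^sup>+ y. f y \<partial>P t x1) = (\<integral>\<^sup>+ u. p u * f u \<partial>L)"
    and int_P2: "(\<integral>\<^sup>+ y. f y \<partial>P t x2) = (\<integral>\<^sup>+ u. q u * f u \<partial>L)"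
    if [measurable]: "f \<in> borel_measurable borel" for f
    by (simp_all add: P1[symmetric] P2[symmetric] nn_integral_density)
  have int_p: "(\<integral>\<^sup>+ u. p u \<partial>L) = 1" and int_q: "(\<integral>\<^sup>+ u. q u \<partial>L) = 1"
    using int_P1[of "\<lambda>_. 1"] int_P2[of "\<lambda>_. 1"]
    by (simp_all add: prob_space.emeasure_space_1[OF prob_space_kernel, simplified])
  have "(\<integral>\<^sup>+ u. m u \<partial>L) \<le> (\<integral>\<^sup>+ u. p u \<partial>L)"
    by (intro nn_integral_mono) (simp add: m_def)
  then have int_m_le: "(\<integral>\<^sup>+ u. m u \<partial>L) \<le> 1" by (simp add: int_p)
  moreover have "\<kappa> = enn2real (\<integral>\<^sup>+ u. m u \<partial>L)"
    using ac_deriv_overlap[OF L.sigma_finite_measure_axioms, of p q]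
    by (simp add: \<kappa>_def kappa_def P1 P2 int_p m_def)
  \<comment> \<open>The integral is at most 1, so the \<open>enn2real\<close> in
    \<open>kappa\<close> loses nothing.\<close>
  ultimately have int_m: "(\<integral>\<^sup>+ u. m u \<partial>L) = ennreal \<kappa>" and \<kappa>: "0 \<le> \<kappa>" "\<kappa> \<le> 1"
    by (auto simp: le_less_trans intro: enn2real_leI)
  define c where "c = ennreal (1 - \<kappa>)"
  have c_sum: "c + ennreal \<kappa> = 1"
    using \<kappa> by (simp add: c_def flip: ennreal_plus)
  \<comment> \<open>Splits a law into its residual and the common part; \<open>m u \<le> r u\<close>
    is required because subtraction in \<open>ennreal\<close> truncates at 0.\<close>
  have residual: "(\<integral>\<^sup>+ u. (r u - m u) * f u \<partial>L) + (\<integral>\<^sup>+ u. m u * f u \<partial>L) = (\<integral>\<^sup>+ u. r u * f u \<partial>L)"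
    if [measurable]: "r \<in> borel_measurable borel" "f \<in> borel_measurable borel"
      and "\<And>u. m u \<le> r u" for r f
  proof -
    have "(r u - m u) * f u + m u * f u = r u * f u" for u
      using that(3)[of u] by (simp add: diff_add_cancel_ennreal flip: distrib_right)
    then show ?thesis by (simp flip: nn_integral_add)
  qed
  have m_le: "m u \<le> p u" "m u \<le> q u" for u by (simp_all add: m_def)
  have res_1: "(\<integral>\<^sup>+ u. r u - m u \<partial>L) = c"
    if [measurable]: "r \<in> borel_measurable borel" and "\<And>u. m u \<le> r u" "(\<integral>\<^sup>+ u. r u \<partial>L) = 1" for r
  proof -
    have "(\<integral>\<^sup>+ u. r u - m u \<partial>L) + ennreal \<kappa> = c + ennreal \<kappa>"
      using residual[of r "\<lambda>_. 1"] that by (simp add: int_m c_sum)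
    then show ?thesis by simp
  qed
  note res_p = res_1[of p] and res_q = res_1[of q]
  show ?thesis
  proof (cases "\<kappa> = 1")
    case True
    \<comment> \<open>The residual has mass 0, so the first law reduces to the common part, which
      the second law dominates. The term with \<open>V_hat\<close> is merely nonnegative.\<close>
    have "(\<integral>\<^sup>+ u. (p u - m u) * h u \<partial>L) \<le> (\<integral>\<^sup>+ u. p u - m u \<partial>L)"
      using h_le by (intro nn_integral_mono) (metis mult.right_neutral mult_left_mono zero_le)
    also have "\<dots> = 0"
      using res_p m_le int_p True by (simp add: c_def)
    finally have "(\<integral>\<^sup>+ u. p u * h u \<partial>L) = (\<integral>\<^sup>+ u. m u * h u \<partial>L)"
      using residual[of p h] m_le by simp
    also have "\<dots> \<le> (\<integral>\<^sup>+ u. q u * h u \<partial>L)"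
      by (intro nn_integral_mono mult_right_mono m_le) simp
    finally show ?thesis
      by (simp add: int_P1 int_P2 add_increasing2)
  next
    case False
    then have c: "c \<noteq> 0" "c \<noteq> \<top>" using \<kappa> by (simp_all add: c_def)
    \<comment> \<open>The factors of \<open>coupled_step\<close> at a start off the diagonal, where
      the fourth component is \<open>True\<close>.\<close>
    define N1 where "N1 = density L (\<lambda>u. (p u - m u) / c)"
    define N2 where "N2 = density L (\<lambda>u. (q u - m u) / c)"
    define N3 where "N3 = (if \<kappa> \<noteq> 0 then density L (\<lambda>u. m u / ennreal \<kappa>) else P t x1)"
    define N4 where "N4 = measure_pmf (bernoulli_pmf (1 - \<kappa>))"
    define K where "K = N1 \<Otimes>\<^sub>M (N2 \<Otimes>\<^sub>M (N3 \<Otimes>\<^sub>M N4))"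
    define U where "U = uniform_measure K uncoupled"
    have sets_N [simp, measurable_cong]: "sets N1 = sets borel" "sets N2 = sets borel"
      "sets N3 = sets borel" "sets N4 = sets (count_space UNIV)"
      by (simp_all add: N1_def N2_def N3_def N4_def)
    have K: "coupled_step P t (coupled_start x1 x2) = K"
      using False \<open>x1 \<noteq> x2\<close>
      by (simp add: coupled_step_def coupled_start_def Let_def K_def N1_def N2_def N3_def N4_def
          L_def p_def q_def m_def \<kappa>_def c_def)
    have prob: "prob_space N1" "prob_space N2" "prob_space N3" "prob_space N4"
    proof -
      show "prob_space N1"
        using res_p m_le int_p c
        by (intro prob_spaceI) (simp add: N1_def emeasure_density nn_integral_divide ennreal_divide_self less_top)
      show "prob_space N2"
        using res_q m_le int_q c
        by (intro prob_spaceI) (simp add: N2_def emeasure_density nn_integral_divide ennreal_divide_self less_top)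
      show "prob_space N3"
      proof (cases "\<kappa> = 0")
        case False
        then show ?thesis using \<kappa>
          by (intro prob_spaceI) (simp add: N3_def emeasure_density nn_integral_divide ennreal_divide_self less_top int_m)
      qed (simp add: N3_def prob_space_kernel)
      show "prob_space N4" unfolding N4_def by (rule prob_space_measure_pmf)
    qed
    have N4_True: "emeasure N4 {True} = c"
      using \<kappa> by (simp add: N4_def emeasure_pmf_single c_def)
    have unc: "uncoupled = {s. snd (snd (snd s))}"
      by (auto simp: uncoupled_def)
    have "{s \<in> space K. snd (snd (snd s))} \<in> sets K"
      unfolding K_def by measurable
    moreover have "space K = UNIV"
      using sets_N[THEN sets_eq_imp_space_eq] by (simp add: K_def space_pair_measure)
    ultimately have [measurable]: "uncoupled \<in> sets K" by (simp add: unc)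
    note marg = nn_integral_uncoupled_fst[OF prob] nn_integral_uncoupled_snd[OF prob]
    have K_unc: "emeasure K uncoupled = c"
      using marg(1)[of "\<lambda>_. 1"] N4_True prob_space.emeasure_space_1[OF prob(1)]
      by (simp add: unc[symmetric] K_def[symmetric])
    have [measurable]: "(\<lambda>s. h (fst s)) \<in> borel_measurable K" "(\<lambda>s. h (fst (snd s))) \<in> borel_measurable K"
      unfolding K_def by measurable
    \<comment> \<open>The mass \<open>c\<close> of the event cancels the factor
      \<open>emeasure N4 {True}\<close>: given no coupling, the first two components still have the
      laws \<open>N1\<close> and \<open>N2\<close>.\<close>
    have U1: "(\<integral>\<^sup>+ s. h (fst s) \<partial>U) = (\<integral>\<^sup>+ u. h u \<partial>N1)"
      and U2: "(\<integral>\<^sup>+ s. h (fst (snd s)) \<partial>U) = (\<integral>\<^sup>+ u. h u \<partial>N2)"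
      using marg(1)[of h] marg(2)[of h] c N4_True
      by (simp_all add: U_def nn_integral_uniform_measure K_unc unc[symmetric] K_def[symmetric]
          ennreal_mult_divide_eq)
    \<comment> \<open>The sum dominates \<open>h (fst s)\<close> also where the truncated difference
      is 0. Only measurable integrands are added; \<open>F\<close> enters afterwards by monotonicity
      alone.\<close>
    have "(\<integral>\<^sup>+ s. h (fst s) \<partial>U) \<le> (\<integral>\<^sup>+ s. h (fst (snd s)) + (h (fst s) - h (fst (snd s))) \<partial>U)"
      by (intro nn_integral_mono) (metis add.commute ennreal_minus_le_iff order_refl)
    also have "\<dots> = (\<integral>\<^sup>+ s. h (fst (snd s)) \<partial>U) + (\<integral>\<^sup>+ s. h (fst s) - h (fst (snd s)) \<partial>U)"
      by (rule nn_integral_add) (simp_all add: U_def K_def)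
    also have "(\<integral>\<^sup>+ s. h (fst s) - h (fst (snd s)) \<partial>U) \<le> (\<integral>\<^sup>+ s. off_diag F (X_tilde s) \<partial>U)"
    proof (rule nn_integral_mono_AE)
      have "AE s in U. s \<in> uncoupled"
        unfolding U_def by (rule AE_uniform_measureI) auto
      then show "AE s in U. h (fst s) - h (fst (snd s)) \<le> off_diag F (X_tilde s)"
      proof eventually_elim
        case (elim s)
        obtain y1 y2 w where s: "s = (y1, y2, w, True)"
          using elim by (cases s) (auto simp: uncoupled_def)
        \<comment> \<open>In \<open>ennreal\<close>, \<open>\<top> - \<top> = \<top>\<close>.
          Finiteness makes the difference 0 on the diagonal, where \<open>off_diag F\<close> is 0
          too, and lets \<open>h y2\<close> be moved across the inequality elsewhere.\<close>
        have h_fin: "h y2 \<noteq> \<top>" using h_le[of y2] by (auto simp: top_unique)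
        show ?case
        proof (cases "y1 = y2")
          case True
          with True h_fin show ?thesis by (simp add: s)
        next
          case False
          then show ?thesis
            using F[of y1 y2] h_fin by (simp add: s X_tilde_def off_diag_def ennreal_minus_le_iff)
        qed
      qed
    qed
    finally have N_le: "(\<integral>\<^sup>+ u. h u \<partial>N1) \<le> (\<integral>\<^sup>+ u. h u \<partial>N2) + (\<integral>\<^sup>+ s. off_diag F (X_tilde s) \<partial>U)"
      by (simp add: U1 U2)
    \<comment> \<open>Multiplication by \<open>c\<close> undoes the normalisation of the residual
      densities.\<close>
    have c_N: "c * (\<integral>\<^sup>+ u. h u \<partial>N1) = (\<integral>\<^sup>+ u. (p u - m u) * h u \<partial>L)"
       "c * (\<integral>\<^sup>+ u. h u \<partial>N2) = (\<integral>\<^sup>+ u. (q u - m u) * h u \<partial>L)"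
      using c by (simp_all add: N1_def N2_def nn_integral_density ennreal_times_divide ennreal_divide_times
          mult_divide_eq_ennreal mult.commute[of c] flip: nn_integral_multc)
    \<comment> \<open>The common part is carried along unchanged and recombines with the residual of
      the second law into that law.\<close>
    have "(\<integral>\<^sup>+ u. p u * h u \<partial>L) = c * (\<integral>\<^sup>+ u. h u \<partial>N1) + (\<integral>\<^sup>+ u. m u * h u \<partial>L)"
      using residual[of p h] m_le by (simp add: c_N)
    also have "\<dots> \<le> c * ((\<integral>\<^sup>+ u. h u \<partial>N2) + (\<integral>\<^sup>+ s. off_diag F (X_tilde s) \<partial>U)) + (\<integral>\<^sup>+ u. m u * h u \<partial>L)"
      by (intro add_right_mono mult_left_mono N_le) simp
    also have "\<dots> = ((\<integral>\<^sup>+ u. (q u - m u) * h u \<partial>L) + (\<integral>\<^sup>+ u. m u * h u \<partial>L)) + c * (\<integral>\<^sup>+ s. off_diag F (X_tilde s) \<partial>U)"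
      by (simp add: distrib_left c_N ac_simps)
    also have "\<dots> = (\<integral>\<^sup>+ u. q u * h u \<partial>L) + V_hat P t F (x1, x2)"
      using residual[of q h] m_le \<open>x1 \<noteq> x2\<close>
      by (simp add: V_hat_def off_diag_def[of "case_prod _"] K U_def c_def \<kappa>_def)
    finally show ?thesis by (simp add: int_P1 int_P2)
  qed
qed

section \<open>Iteration over times and integration over starting points\<close>

text \<open>Induction from the front of the list: the one-step comparison is applied to
  \<open>backward ts h\<close>, with the remaining operator product at 1 as \<open>F\<close>. For
  the empty list the bound is \<open>h x1 \<le> 1\<close>.\<close>

lemma backward_le_V_hat:
  assumes h [measurable]: "h \<in> borel_measurable borel" and h_le: "\<And>x. h x \<le> 1"
    and "x1 \<noteq> x2"
  shows "backward ts h x1 \<le> backward ts h x2 + foldr (\<lambda>t. (\<circ>) (V_hat P t)) ts id (\<lambda>_. 1) (x1, x2)"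
  using \<open>x1 \<noteq> x2\<close>
proof (induction ts arbitrary: x1 x2)
  case Nil
  then show ?case using h_le[of x1] by (simp add: add_increasing)
next
  case (Cons t ts)
  let ?F = "\<lambda>ts. foldr (\<lambda>t. (\<circ>) (V_hat P t)) ts id (\<lambda>_. 1)"
  have "?F (t # ts) = V_hat P t (?F ts)"
    by (simp only: foldr_Cons comp_apply)
  moreover have "(\<integral>\<^sup>+ y. backward ts h y \<partial>P t x1)
      \<le> (\<integral>\<^sup>+ y. backward ts h y \<partial>P t x2) + V_hat P t (?F ts) (x1, x2)"
    by (rule V_hat_bound[OF measurable_backward[OF h] backward_le_1[of h, OF h_le]])
      (use Cons in blast)+
  ultimately show ?case
    unfolding foldr_Cons[of "\<lambda>t h x. \<integral>\<^sup>+ y. h y \<partial>P t x"] comp_apply[of "\<lambda>h x. \<integral>\<^sup>+ y. h y \<partial>P t x"]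
    by (simp only:)
qed

text \<open>The two starting points are drawn independently, and the product measure has marginals
  \<open>\<mu>1\<close> and \<open>\<mu>2\<close>. Pairs on the diagonal contribute nothing to the
  difference of expectations, so the indicator may stand on the right.\<close>

lemma nn_integral_law_at_le:
  fixes \<mu>1 \<mu>2 :: "'a measure"
  assumes mu: "prob_space \<mu>1" "sets \<mu>1 = sets borel" "prob_space \<mu>2" "sets \<mu>2 = sets borel"
    and h [measurable]: "h \<in> borel_measurable borel" and h_le: "\<And>x. h x \<le> 1"
  shows "(\<integral>\<^sup>+ x. h x \<partial>law_at P \<mu>1 n) \<le> (\<integral>\<^sup>+ x. h x \<partial>law_at P \<mu>2 n)
    + (\<integral>\<^sup>+ (x1, x2). V_hat_prod P n (\<lambda>_. 1) (x1, x2) *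
          indicator {(y1, y2). y1 \<noteq> y2} (x1, x2) \<partial>(\<mu>1 \<Otimes>\<^sub>M \<mu>2))"
proof -
  interpret M1: prob_space \<mu>1 by fact
  interpret M2: prob_space \<mu>2 by fact
  note [measurable_cong] = mu(2,4)
  define H where "H = backward [0..<n] h"
  have [measurable]: "H \<in> borel_measurable borel" unfolding H_def by measurable
  have "(\<integral>\<^sup>+ x. H x \<partial>\<mu>1) = (\<integral>\<^sup>+ z. H (fst z) \<partial>(\<mu>1 \<Otimes>\<^sub>M \<mu>2))"
    by (subst M2.nn_integral_fst[symmetric]) (simp_all add: M2.emeasure_space_1)
  also have "\<dots> \<le> (\<integral>\<^sup>+ z. H (snd z) + (H (fst z) - H (snd z)) \<partial>(\<mu>1 \<Otimes>\<^sub>M \<mu>2))"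
    by (intro nn_integral_mono) (metis add.commute ennreal_minus_le_iff order_refl)
  also have "\<dots> = (\<integral>\<^sup>+ z. H (snd z) \<partial>(\<mu>1 \<Otimes>\<^sub>M \<mu>2)) + (\<integral>\<^sup>+ z. H (fst z) - H (snd z) \<partial>(\<mu>1 \<Otimes>\<^sub>M \<mu>2))"
    by (rule nn_integral_add) simp_all
  also have "(\<integral>\<^sup>+ z. H (snd z) \<partial>(\<mu>1 \<Otimes>\<^sub>M \<mu>2)) = (\<integral>\<^sup>+ x. H x \<partial>\<mu>2)"
    by (subst M2.nn_integral_fst[symmetric]) (simp_all add: M1.emeasure_space_1)
  also have "(\<integral>\<^sup>+ z. H (fst z) - H (snd z) \<partial>(\<mu>1 \<Otimes>\<^sub>M \<mu>2))
      \<le> (\<integral>\<^sup>+ (x1, x2). V_hat_prod P n (\<lambda>_. 1) (x1, x2) *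
          indicator {(y1, y2). y1 \<noteq> y2} (x1, x2) \<partial>(\<mu>1 \<Otimes>\<^sub>M \<mu>2))"
  proof (rule nn_integral_mono)
    fix z :: "'a \<times> 'a"
    obtain x1 x2 where z: "z = (x1, x2)" by (cases z)
    have "H x2 \<noteq> \<top>"
      using backward_le_1[of h "[0..<n]" x2, OF h_le] by (auto simp: H_def top_unique)
    then show "H (fst z) - H (snd z) \<le> (case z of (x1, x2) \<Rightarrow> V_hat_prod P n (\<lambda>_. 1) (x1, x2) *
          indicator {(y1, y2). y1 \<noteq> y2} (x1, x2))"
      using backward_le_V_hat[OF h h_le, where ts = "[0..<n]" and ?x1.0 = x1 and ?x2.0 = x2]
      by (cases "x1 = x2") (simp_all add: z H_def V_hat_prod_def ennreal_minus_le_iff)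
  qed
  finally show ?thesis
    by (simp add: nn_integral_law_at mu H_def add_left_mono)
qed

text \<open>The one-sided bound for an event and for its complement together control the absolute
  difference, without exchanging the two initial laws. The factor 2 is the normalisation of
  \<open>tv_norm\<close>.\<close>

lemma tv_norm_law_at_le:
  fixes \<mu>1 \<mu>2 :: "'a measure"
  assumes mu: "prob_space \<mu>1" "sets \<mu>1 = sets borel" "prob_space \<mu>2" "sets \<mu>2 = sets borel"
  shows "ennreal (tv_norm (law_at P \<mu>1 n) (law_at P \<mu>2 n)) \<le> 2 *
    (\<integral>\<^sup>+ (x1, x2). V_hat_prod P n (\<lambda>_. 1) (x1, x2) *
          indicator {(y1, y2). y1 \<noteq> y2} (x1, x2) \<partial>(\<mu>1 \<Otimes>\<^sub>M \<mu>2))"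
    (is "_ \<le> 2 * ?I")
proof (cases "?I")
  case top
  then show ?thesis by (simp add: ennreal_mult_top)
next
  case (real I)
  interpret M: prob_space "law_at P \<mu>1 n" by (intro prob_space_law_at mu)
  interpret N: prob_space "law_at P \<mu>2 n" by (intro prob_space_law_at mu)
  have sets: "sets (law_at P \<mu>1 n) = sets borel" "sets (law_at P \<mu>2 n) = sets borel"
    by (intro sets_law_at mu)+
  have space: "space (law_at P \<mu>1 n) = UNIV" "space (law_at P \<mu>2 n) = UNIV"
    using sets[THEN sets_eq_imp_space_eq] by simp_all
  have int: "(\<integral>\<^sup>+ x. indicator A x \<partial>law_at P \<mu>1 n) = ennreal (measure (law_at P \<mu>1 n) A)"
    "(\<integral>\<^sup>+ x. indicator A x \<partial>law_at P \<mu>2 n) = ennreal (measure (law_at P \<mu>2 n) A)"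
    if "A \<in> sets borel" for A
    using that sets by (simp_all add: M.emeasure_eq_measure N.emeasure_eq_measure)
  have le: "measure (law_at P \<mu>1 n) A \<le> measure (law_at P \<mu>2 n) A + I"
    if A: "A \<in> sets borel" for A
  proof -
    have "ennreal (measure (law_at P \<mu>1 n) A) \<le> ennreal (measure (law_at P \<mu>2 n) A) + ennreal I"
      using nn_integral_law_at_le[OF mu, of "indicator A" n] A
      unfolding real(2) int[OF A] by (simp add: indicator_def)
    then show ?thesis
      using real(1) by (simp flip: ennreal_plus)
  qed
  have "\<bar>measure (law_at P \<mu>1 n) A - measure (law_at P \<mu>2 n) A\<bar> \<le> I"
    if A: "A \<in> sets borel" for A
    using le[OF A] le[of "UNIV - A"] A M.prob_compl[of A] N.prob_compl[of A]
    by (auto simp: sets space)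
  then have "(SUP A\<in>sets (law_at P \<mu>1 n). \<bar>measure (law_at P \<mu>1 n) A - measure (law_at P \<mu>2 n) A\<bar>) \<le> I"
    by (intro cSUP_least) (auto simp: sets)
  then have "ennreal (tv_norm (law_at P \<mu>1 n) (law_at P \<mu>2 n)) \<le> ennreal (2 * I)"
    unfolding tv_norm_def by (intro ennreal_leI) simp
  also have "\<dots> = 2 * ?I"
    using real by (simp add: ennreal_mult)
  finally show ?thesis .
qed

end

section \<open>Logarithms and exponential rates\<close>

lemma ext_ln_mono: "x \<le> y \<Longrightarrow> ext_ln x \<le> ext_ln y"
  by (cases x; cases y) (auto simp: ext_ln_def top_unique ennreal_eq_0_iff)

text \<open>As \<open>ln c\<close> is finite, the sum is meaningful also at \<open>x = 0\<close> and
  \<open>x = \<top>\<close>, where both sides are the same infinity.\<close>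

lemma ext_ln_cmult:
  assumes "0 < c"
  shows "ext_ln (ennreal c * x) = ereal (ln c) + ext_ln x"
  using assms
  by (cases x) (auto simp: ext_ln_def ln_mult ennreal_eq_0_iff ennreal_mult_top
      mult_le_0_iff simp flip: ennreal_mult)

theorem theorem20:
  fixes P :: "nat \<Rightarrow> 'a::topological_space \<Rightarrow> 'a measure"
    and \<mu>1 \<mu>2 :: "'a measure"
  assumes singletons: "\<And>x::'a. {x} \<in> sets borel"
    and kernel_sets: "\<And>t x. sets (P t x) = sets borel"
    and kernel_prob: "\<And>t x. prob_space (P t x)"
    and kernel_meas: "\<And>t A. A \<in> sets borel \<Longrightarrow> (\<lambda>x. measure (P t x) A) \<in> borel_measurable borel"
    and mu1: "prob_space \<mu>1" "sets \<mu>1 = sets borel"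
    and mu2: "prob_space \<mu>2" "sets \<mu>2 = sets borel"
  shows "limsup (\<lambda>n. ereal (1 / real n) *
             ext_ln (ennreal (tv_norm (law_at P \<mu>1 n) (law_at P \<mu>2 n))))
         \<le> limsup (\<lambda>n. ereal (1 / real n) *
             ext_ln (\<integral>\<^sup>+ (x1, x2). V_hat_prod P n (\<lambda>_. 1) (x1, x2) *
                        indicator {(y1, y2). y1 \<noteq> y2} (x1, x2) \<partial>(\<mu>1 \<Otimes>\<^sub>M \<mu>2)))"
proof -
  interpret markov_kernels P
    by (rule markov_kernels.intro) (fact kernel_sets kernel_prob kernel_meas)+
  define tv where "tv n = ennreal (tv_norm (law_at P \<mu>1 n) (law_at P \<mu>2 n))" for n
  define I where "I n = (\<integral>\<^sup>+ (x1, x2). V_hat_prod P n (\<lambda>_. 1) (x1, x2) *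
                        indicator {(y1, y2). y1 \<noteq> y2} (x1, x2) \<partial>(\<mu>1 \<Otimes>\<^sub>M \<mu>2))" for n
  \<comment> \<open>Index 0, where \<open>1 / real 0 = 0\<close>, is left out; it does not affect a
    limsup.\<close>
  have "ereal (1 / real n) * ext_ln (tv n)
      \<le> ereal (ln 2 / real n) + ereal (1 / real n) * ext_ln (I n)" if "n > 0" for n
  proof -
    have "ext_ln (tv n) \<le> ext_ln (ennreal 2 * I n)"
      using tv_norm_law_at_le[OF mu1 mu2, of n] by (intro ext_ln_mono) (simp add: tv_def I_def)
    also have "\<dots> = ereal (ln 2) + ext_ln (I n)" by (rule ext_ln_cmult) simp
    finally have "ereal (1 / real n) * ext_ln (tv n) \<le> ereal (1 / real n) * (ereal (ln 2) + ext_ln (I n))"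
      by (intro ereal_mult_left_mono) simp_all
    also have "\<dots> = ereal (ln 2 / real n) + ereal (1 / real n) * ext_ln (I n)"
      \<comment> \<open>A positive factor distributes over the sum even if
        \<open>ext_ln (I n)\<close> is infinite.\<close>
      using that by (cases "ext_ln (I n)") (simp_all add: field_simps)
    finally show ?thesis .
  qed
  then have "limsup (\<lambda>n. ereal (1 / real n) * ext_ln (tv n))
      \<le> limsup (\<lambda>n. ereal (ln 2 / real n) + ereal (1 / real n) * ext_ln (I n))"
    by (intro Limsup_mono eventually_mono[OF eventually_gt_at_top[of 0]])
  also have "\<dots> = 0 + limsup (\<lambda>n. ereal (1 / real n) * ext_ln (I n))"
    \<comment> \<open>\<open>ln 2 / real n\<close> converges to the finite limit 0, so it splits off
      from the limsup.\<close>
    by (rule ereal_limsup_lim_add) (simp_all add: zero_ereal_def lim_const_over_n)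
  finally show ?thesis by (simp add: tv_def I_def)
qed

end
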